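(* Let $(A,* )$ be the free distributive algebra on one generator. Then $a<a$ does not hold for any $a\in A$; that is, there are no $a\in A$, integer $k\geq 1$ and $b_1,\dots,b_k\in A$ with $$a=((\cdots((a*b_1)*b_2)*\cdots)*b_{k-1})*b_k .$$
   Context: A distributive algebra is a set $A$ with a binary operation $*$ satisfying the (left) distributive law $a*(b*c)=(a*b)*(a*c)$ for all $a,b,c\in A$. The free distributive algebra on one generator is the free object on one generator in the variety of such algebras. On a distributive algebra, the relation $a<b$ is defined to hold iff there are $k\ge 1$ and $b_1,\dots,b_k\in A$ with $b=((\cdots((a*b_1)*b_2)*\cdots)*b_{k-1})*b_k$. Irreflexivity is the assertion that $a<a$ holds for no $a\in A$. *)

theory Defs
  imports Main
begin

definition distributive_algebra :: "'a set \<Rightarrow> ('a \<Rightarrow> 'a \<Rightarrow> 'a) \<Rightarrow> bool" where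
  "distributive_algebra A f \<longleftrightarrow>
     (\<forall>a\<in>A. \<forall>b\<in>A. f a b \<in> A) \<and>
     (\<forall>a\<in>A. \<forall>b\<in>A. \<forall>c\<in>A. f a (f b c) = f (f a b) (f a c))"

text \<open>
  The list \<open>[b\<^sub>1, \<dots>, b\<^sub>k]\<close> is nonempty, i.e. \<open>k \<ge> 1\<close>, and \<open>foldl\<close> yields the
  left-bracketed product starting at \<open>a\<close>.
\<close>

definition ld_less :: "'a set \<Rightarrow> ('a \<Rightarrow> 'a \<Rightarrow> 'a) \<Rightarrow> 'a \<Rightarrow> 'a \<Rightarrow> bool" where
  "ld_less A f a b \<longleftrightarrow> (\<exists>bs. bs \<noteq> [] \<and> set bs \<subseteq> A \<and> b = foldl f a bs)"

datatype ld_term = Gen | App ld_term ld_term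

inductive ld_eq :: "ld_term \<Rightarrow> ld_term \<Rightarrow> bool" where
  dist: "ld_eq (App a (App b c)) (App (App a b) (App a c))"
| refl: "ld_eq a a"
| sym: "ld_eq a b \<Longrightarrow> ld_eq b a"
| trans: "ld_eq a b \<Longrightarrow> ld_eq b c \<Longrightarrow> ld_eq a c"
| cong: "ld_eq a a' \<Longrightarrow> ld_eq b b' \<Longrightarrow> ld_eq (App a b) (App a' b')"

lemma equivp_ld_eq: "equivp ld_eq"
  by (rule equivpI) (auto intro!: reflpI sympI transpI intro: ld_eq.refl ld_eq.sym ld_eq.trans)

quotient_type free_ld = ld_term / ld_eq
  by (rule equivp_ld_eq)

lift_definition ld_gen :: free_ld is Gen .

lift_definition ld_mult :: "free_ld \<Rightarrow> free_ld \<Rightarrow> free_ld" (infixl "\<star>" 70) is App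
  by (rule ld_eq.cong)

lemma distributive_algebra_free_ld: "distributive_algebra UNIV (\<star>)"
proof -
  have "a \<star> (b \<star> c) = (a \<star> b) \<star> (a \<star> c)" for a b c
    by transfer (rule ld_eq.dist)
  then show ?thesis
    unfolding distributive_algebra_def by blast
qed

lemma free_ld_induct [case_names gen mult, induct type: free_ld]:
  assumes "P ld_gen" and "\<And>a b. P a \<Longrightarrow> P b \<Longrightarrow> P (a \<star> b)"
  shows "P a"
proof (induction a rule: free_ld.abs_induct)
  case (1 t)
  show ?case
  proof (induction t)
    case Gen
    show ?case using assms(1) by (simp only: ld_gen.abs_eq)
  next
    case (App s t)
    then show ?case using assms(2) by (metis ld_mult.abs_eq)
  qed
qed

primrec ld_term_eval :: "('a \<Rightarrow> 'a \<Rightarrow> 'a) \<Rightarrow> 'a \<Rightarrow> ld_term \<Rightarrow> 'a" where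
  "ld_term_eval f x Gen = x"
| "ld_term_eval f x (App s t) = f (ld_term_eval f x s) (ld_term_eval f x t)"

lemma ld_term_eval_closed:
  assumes "distributive_algebra B f" and "x \<in> B"
  shows "ld_term_eval f x t \<in> B"
proof (induction t)
  case Gen
  show ?case using assms(2) by simp
next
  case (App s t)
  then show ?case using assms(1) unfolding distributive_algebra_def ld_term_eval.simps by blast
qed

lemma ld_term_eval_cong:
  assumes "ld_eq s t" and "distributive_algebra B f" and "x \<in> B"
  shows "ld_term_eval f x s = ld_term_eval f x t"
  using assms(1)
proof (induction rule: ld_eq.induct)
  case (dist a b c)
  then show ?case
    using assms(2) ld_term_eval_closed[OF assms(2,3)]
    unfolding distributive_algebra_def ld_term_eval.simps by blast
qed auto

text \<open>The universal property of the free distributive algebra on one generator.\<close>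

theorem free_ld_universal:
  assumes B: "distributive_algebra B f" and x: "x \<in> B"
  shows "\<exists>!h. range h \<subseteq> B \<and> h ld_gen = x \<and> (\<forall>a b. h (a \<star> b) = f (h a) (h b))"
proof (rule ex_ex1I)
  define h where "h a = ld_term_eval f x (rep_free_ld a)" for a
  have h_abs: "h (abs_free_ld t) = ld_term_eval f x t" for t
    unfolding h_def
    by (rule ld_term_eval_cong[OF _ B x])
      (metis Quotient_free_ld Quotient_rep_abs ld_eq.refl)
  have "h ld_gen = x"
    by (simp add: ld_gen.abs_eq h_abs)
  moreover have "h (a \<star> b) = f (h a) (h b)" for a b
    by (induction a rule: free_ld.abs_induct, induction b rule: free_ld.abs_induct)
      (simp add: ld_mult.abs_eq h_abs)
  moreover have "range h \<subseteq> B"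
    using ld_term_eval_closed[OF B x] by (auto simp: h_def)
  ultimately show "\<exists>h. range h \<subseteq> B \<and> h ld_gen = x \<and> (\<forall>a b. h (a \<star> b) = f (h a) (h b))"
    by blast
next
  fix h k
  assume h: "range h \<subseteq> B \<and> h ld_gen = x \<and> (\<forall>a b. h (a \<star> b) = f (h a) (h b))"
    and k: "range k \<subseteq> B \<and> k ld_gen = x \<and> (\<forall>a b. k (a \<star> b) = f (k a) (k b))"
  have "h a = k a" for a
    by (induction a rule: free_ld_induct) (simp_all add: h k)
  then show "h = k" ..
qed

end

theory Submission
  imports Defs
begin

text \<open>
  Irreflexivity can be tested on the image of the free algebra in any other distributive
  algebra, and the proof (due to Dehornoy, with Larue's argument for the final step) uses one
  built from braids. Let \<open>G\<close> be a group with an endomorphism \<open>s\<close> and an element \<open>x\<close> such that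
  \<open>x \<cdot> s x \<cdot> x = s x \<cdot> x \<cdot> s x\<close> and \<open>x\<close> commutes with every \<open>s (s g)\<close>. Then
  \<open>f * g = f \<cdot> s g \<cdot> x \<cdot> (s f)\<^sup>-\<^sup>1\<close> is distributive (\<open>bracket_distrib\<close>). In this algebra
  \<open>f\<^sup>-\<^sup>1 \<cdot> (f * g)\<close> is \<open>s g \<cdot> x \<cdot> (s f)\<^sup>-\<^sup>1\<close>, so \<open>f < f\<close> would write the unit of \<open>G\<close> as a nonempty
  product of factors from \<open>s G \<cdot> x \<cdot> s G\<close>: elements of \<open>s G\<close> and positive powers of \<open>x\<close> only.

  Take for \<open>G\<close> the automorphisms of the free group on \<open>a\<^sub>0, a\<^sub>1, \<dots>\<close>, for \<open>s f\<close> the automorphism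
  that fixes \<open>a\<^sub>0\<close> and acts as \<open>f\<close> on the remaining generators, and for \<open>x\<close> Artin's automorphism
  \<open>a\<^sub>0 \<mapsto> a\<^sub>0\<^sup>-\<^sup>1 a\<^sub>1 a\<^sub>0\<close>, \<open>a\<^sub>1 \<mapsto> a\<^sub>0\<close>. Let \<open>W\<close> be the set of reduced words that begin with
  \<open>a\<^sub>0\<^sup>-\<^sup>1\<close>. Every \<open>s f\<close> fixes \<open>a\<^sub>0\<close> and maps \<open>W\<close> into itself (\<open>begins_shift_endo\<close>), while \<open>x\<close>
  maps both \<open>a\<^sub>0\<close> and \<open>W\<close> into \<open>W\<close> (\<open>artin_shape_word_of\<close>). Hence each factor sends \<open>a\<^sub>0\<close> and \<open>W\<close>
  into \<open>W\<close>, and so does the product; but the unit does not send \<open>a\<^sub>0\<close> into \<open>W\<close>.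
\<close>

section \<open>The free group on countably many generators\<close>

text \<open>
  The letter \<open>(i, True)\<close> is the generator \<open>a\<^sub>i\<close>, and \<open>(i, False)\<close> is its inverse. The elements of
  the group are the reduced words themselves, so that a statement about first letters is a
  statement about heads of lists.
\<close>
fun letter_inv :: "nat \<times> bool \<Rightarrow> nat \<times> bool" where
  "letter_inv (i, e) = (i, \<not> e)"

lemma letter_inv_inv [simp]: "letter_inv (letter_inv x) = x"
  by (cases x) simp

fun reduced :: "(nat \<times> bool) list \<Rightarrow> bool" where
  "reduced [] \<longleftrightarrow> True"
| "reduced [x] \<longleftrightarrow> True"
| "reduced (x # y # w) \<longleftrightarrow> y \<noteq> letter_inv x \<and> reduced (y # w)"

fun push :: "nat \<times> bool \<Rightarrow> (nat \<times> bool) list \<Rightarrow> (nat \<times> bool) list" where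
  "push x [] = [x]"
| "push x (y # w) = (if y = letter_inv x then w else x # y # w)"

lemma reduced_ConsD: "reduced (x # w) \<Longrightarrow> reduced w"
  by (cases w) auto

lemma reduced_push: "reduced w \<Longrightarrow> reduced (push x w)"
  by (cases w) (auto dest: reduced_ConsD)

lemma push_reduced: "reduced (x # w) \<Longrightarrow> push x w = x # w"
  by (cases w) auto

lemma push_push_inv: "reduced w \<Longrightarrow> push x (push (letter_inv x) w) = w"
  by (cases w) (auto simp: push_reduced)

lemma reduced_foldr_push: "reduced w \<Longrightarrow> reduced (foldr push u w)"
  by (induction u) (auto simp: reduced_push)

lemma foldr_push_push:
  assumes "reduced u" "reduced w"
  shows "foldr push (push x u) w = push x (foldr push u w)"
proof (cases u)
  case (Cons y v)
  then show ?thesis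
    using assms push_push_inv[OF reduced_foldr_push, of w x v] by auto
qed simp

text \<open>
  Pushing a letter is a bijection of the reduced words, undone by pushing its inverse. So
  cancelling inside the left factor changes nothing in the product, which gives associativity.
\<close>
lemma foldr_push_assoc:
  assumes "reduced v" "reduced w"
  shows "foldr push (foldr push u v) w = foldr push u (foldr push v w)"
  using assms by (induction u) (simp_all add: foldr_push_push reduced_foldr_push)

lemma foldr_push_Nil: "reduced w \<Longrightarrow> foldr push w [] = w"
  by (induction w) (simp_all add: push_reduced reduced_ConsD)

lemma foldr_push_inverse:
  assumes "reduced w"
  shows "foldr push (rev (map letter_inv u)) (foldr push u w) = w"
  using assms
proof (induction u arbitrary: w)
  case (Cons x u)
  then show ?case
    using push_push_inv[of "foldr push u w" "letter_inv x"]
    by (simp add: reduced_foldr_push)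
qed simp

lemma foldr_push_append_inverse:
  assumes "reduced u" "reduced w"
  shows "foldr push (foldr push (rev (map letter_inv u)) []) w
       = foldr push (rev (map letter_inv u)) w"
  using foldr_push_assoc[of "[]" w "rev (map letter_inv u)"] assms by simp

typedef free_group = "{w. reduced w}"
  morphisms word_of Abs_free_group
  by (rule exI[of _ "[]"]) simp

setup_lifting type_definition_free_group

lemma reduced_word_of [simp]: "reduced (word_of u)"
  using word_of by simp

text \<open>
  The class \<open>group_add\<close> does not assume commutativity; \<open>+\<close> is concatenation followed by
  cancellation.
\<close>
instantiation free_group :: group_add
begin

lift_definition zero_free_group :: free_group is "[]" by simp

lift_definition plus_free_group :: "free_group \<Rightarrow> free_group \<Rightarrow> free_group"
  is "foldr push" by (rule reduced_foldr_push)

lift_definition uminus_free_group :: "free_group \<Rightarrow> free_group"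
  is "\<lambda>w. foldr push (rev (map letter_inv w)) []"
  by (simp add: reduced_foldr_push)

definition minus_free_group :: "free_group \<Rightarrow> free_group \<Rightarrow> free_group" where
  "minus_free_group u v = u + - v"

instance
proof
  fix u v w :: free_group
  show "u + v + w = u + (v + w)"
    by transfer (rule foldr_push_assoc)
  show "0 + u = u"
    by transfer simp
  show "u + 0 = u"
    by transfer (rule foldr_push_Nil)
  show "- u + u = 0"
    by transfer (metis foldr_push_append_inverse foldr_push_inverse foldr_push_Nil reduced.simps(1))
  show "u + - v = u - v"
    by (simp add: minus_free_group_def)
qed

end

lift_definition gen :: "nat \<Rightarrow> free_group" is "\<lambda>i. [(i, True)]" by simp

abbreviation letter :: "nat \<times> bool \<Rightarrow> free_group" where
  "letter x \<equiv> (if snd x then gen (fst x) else - gen (fst x))"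

lemma word_of_gen: "word_of (gen i) = [(i, True)]"
  by transfer simp

lemma word_of_uminus_gen: "word_of (- gen i) = [(i, False)]"
  by transfer simp

lemma word_of_0 [simp]: "word_of 0 = []"
  by transfer simp

lemma word_of_letter_add: "word_of (letter x + u) = push x (word_of u)"
  by (cases x) (simp add: plus_free_group.rep_eq word_of_gen word_of_uminus_gen)

lemma word_of_gen_add: "word_of (gen i + u) = push (i, True) (word_of u)"
  "word_of (- gen i + u) = push (i, False) (word_of u)"
  using word_of_letter_add[of "(i, True)"] word_of_letter_add[of "(i, False)"] by simp_all

lemma word_of_eqI: "word_of u = word_of v \<Longrightarrow> u = v"
  by (simp add: word_of_inject)

lemma word_of_ConsE:
  assumes "word_of u = x # w"
  obtains v where "word_of v = w" "u = letter x + v"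
proof
  have red: "reduced (x # w)"
    using reduced_word_of[of u] assms by simp
  then show w: "word_of (Abs_free_group w) = w"
    by (simp add: Abs_free_group_inverse reduced_ConsD)
  show "u = letter x + Abs_free_group w"
    by (rule word_of_eqI) (simp only: assms word_of_letter_add w push_reduced[OF red])
qed

lemma free_group_induct [case_names zero letter]:
  assumes "P 0" and "\<And>x u. word_of (letter x + u) = x # word_of u \<Longrightarrow> P u \<Longrightarrow> P (letter x + u)"
  shows "P u"
proof (induction "word_of u" arbitrary: u)
  case Nil
  then have "u = 0"
    by (intro word_of_eqI) simp
  then show ?case using assms(1) by simp
next
  case (Cons x w)
  obtain v where "word_of v = w" "u = letter x + v"
    using word_of_ConsE[OF Cons.hyps(2)[symmetric]] .
  then show ?case
    using Cons assms(2)[of x v] by metis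
qed

section \<open>Endomorphisms of the free group\<close>

definition endo :: "(free_group \<Rightarrow> free_group) \<Rightarrow> bool" where
  "endo f \<longleftrightarrow> (\<forall>u v. f (u + v) = f u + f v)"

lemma endo_add: "endo f \<Longrightarrow> f (u + v) = f u + f v"
  by (simp add: endo_def)

lemma endo_0: "endo f \<Longrightarrow> f 0 = 0"
  using endo_add[of f 0 0] by (metis add.right_neutral add_left_cancel)

lemma endo_uminus: "endo f \<Longrightarrow> f (- u) = - f u"
  using endo_add[of f "- u" u] endo_0[of f] by (simp add: eq_neg_iff_add_eq_0)

lemmas endo_simps = endo_add endo_0 endo_uminus

lemma endo_eqI:
  assumes "endo f" "endo g" "\<And>i. f (gen i) = g (gen i)"
  shows "f = g"
proof
  fix u
  show "f u = g u"
    by (induction u rule: free_group_induct) (simp_all add: assms endo_simps)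
qed

lemma endo_comp: "endo f \<Longrightarrow> endo g \<Longrightarrow> endo (f \<circ> g)"
  by (simp add: endo_def)

lemma endo_id: "endo id"
  by (simp add: endo_def)

lemma endo_inv:
  assumes "endo f" "bij f"
  shows "endo (inv f)"
  unfolding endo_def
proof (intro allI)
  fix u v
  have "f (inv f (u + v)) = f (inv f u + inv f v)"
    using assms by (simp add: endo_add bij_is_surj surj_f_inv_f)
  then show "inv f (u + v) = inv f u + inv f v"
    using assms(2) by (meson bij_is_inj injD)
qed

definition extend :: "(nat \<Rightarrow> free_group) \<Rightarrow> free_group \<Rightarrow> free_group" where
  "extend g u = foldr (\<lambda>(i, e) acc. (if e then g i else - g i) + acc) (word_of u) 0"

text \<open>
  The word of \<open>letter x + u\<close> may be shorter than that of \<open>u\<close>. The recursion survives such a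
  cancellation because the values at \<open>x\<close> and at its inverse are opposite.
\<close>
lemma extend_letter_add:
  "extend g (letter x + u) = (if snd x then g (fst x) else - g (fst x)) + extend g u"
proof (cases "word_of u")
  case Nil
  then show ?thesis
    by (simp add: extend_def word_of_letter_add split: prod.splits)
next
  case (Cons y w)
  then show ?thesis
    unfolding extend_def word_of_letter_add
    by (cases x; cases y) (auto simp: add.assoc[symmetric])
qed

lemma endo_extend: "endo (extend g)"
  unfolding endo_def
proof (intro allI)
  fix u v
  show "extend g (u + v) = extend g u + extend g v"
  proof (induction u rule: free_group_induct)
    case zero
    show ?case by (simp add: extend_def)
  next
    case (letter x u)
    then show ?case
      by (simp only: add.assoc extend_letter_add)
  qed
qed

lemma extend_gen: "extend g (gen i) = g i"
  by (simp add: extend_def word_of_gen)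

section \<open>The shift and the Artin automorphism\<close>

definition shift :: "free_group \<Rightarrow> free_group" where
  "shift = extend (\<lambda>i. gen (Suc i))"

text \<open>
  The group splits as the free product of the cyclic group of \<open>gen 0\<close> with the image of
  \<open>shift\<close>, a copy of the whole group; \<open>shift_endo f\<close> is the identity on the first factor and
  acts as \<open>f\<close> on the second.
\<close>
definition shift_endo :: "(free_group \<Rightarrow> free_group) \<Rightarrow> free_group \<Rightarrow> free_group" where
  "shift_endo f = extend (\<lambda>i. case i of 0 \<Rightarrow> gen 0 | Suc j \<Rightarrow> shift (f (gen j)))"

text \<open>
  Of the two mirror images of Artin's action of the first braid generator, this is the one
  whose effect shows in the first letters of words rather than in the last ones.
\<close>
definition artin :: "free_group \<Rightarrow> free_group" where
  "artin = extend (\<lambda>i. if i = 0 then - gen 0 + gen 1 + gen 0 else if i = 1 then gen 0 else gen i)"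

definition artin_inv :: "free_group \<Rightarrow> free_group" where
  "artin_inv =
     extend (\<lambda>i. if i = 0 then gen 1 else if i = 1 then gen 1 + gen 0 - gen 1 else gen i)"

lemma endo_shift: "endo shift"
  and endo_shift_endo: "endo (shift_endo f)"
  and endo_artin: "endo artin"
  and endo_artin_inv: "endo artin_inv"
  by (simp_all add: shift_def shift_endo_def artin_def artin_inv_def endo_extend)

lemma shift_gen: "shift (gen i) = gen (Suc i)"
  by (simp add: shift_def extend_gen)

lemma shift_endo_gen:
  "shift_endo f (gen 0) = gen 0" "shift_endo f (gen (Suc i)) = shift (f (gen i))"
  by (simp_all add: shift_endo_def extend_gen)

lemma artin_gen:
  "artin (gen 0) = - gen 0 + gen (Suc 0) + gen 0"
  "artin (gen (Suc 0)) = gen 0"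
  "artin (gen (Suc (Suc i))) = gen (Suc (Suc i))"
  by (simp_all add: artin_def extend_gen)

lemma artin_inv_gen:
  "artin_inv (gen 0) = gen (Suc 0)"
  "artin_inv (gen (Suc 0)) = gen (Suc 0) + gen 0 - gen (Suc 0)"
  "artin_inv (gen (Suc (Suc i))) = gen (Suc (Suc i))"
  by (simp_all add: artin_inv_def extend_gen)

lemma nat_cases_012: "(i = 0 \<Longrightarrow> P) \<Longrightarrow> (i = Suc 0 \<Longrightarrow> P) \<Longrightarrow> (\<And>j. i = Suc (Suc j) \<Longrightarrow> P) \<Longrightarrow> P"
  by (metis nat.exhaust)

lemma bij_artin: "bij artin"
proof (rule o_bij)
  show "artin_inv \<circ> artin = id"
  proof (rule endo_eqI[OF endo_comp[OF endo_artin_inv endo_artin] endo_id])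
    fix i show "(artin_inv \<circ> artin) (gen i) = id (gen i)"
      by (rule nat_cases_012[of i])
        (simp_all add: artin_gen artin_inv_gen endo_simps[OF endo_artin_inv]
          diff_conv_add_uminus add.assoc del: add_uminus_conv_diff)
  qed
  show "artin \<circ> artin_inv = id"
  proof (rule endo_eqI[OF endo_comp[OF endo_artin endo_artin_inv] endo_id])
    fix i show "(artin \<circ> artin_inv) (gen i) = id (gen i)"
      by (rule nat_cases_012[of i])
        (simp_all add: artin_gen artin_inv_gen endo_simps[OF endo_artin]
          diff_conv_add_uminus add.assoc del: add_uminus_conv_diff)
  qed
qed

lemma shift_endo_shift:
  assumes "endo f"
  shows "shift_endo f (shift u) = shift (f u)"
proof -
  have "shift_endo f \<circ> shift = shift \<circ> f"
    by (rule endo_eqI)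
      (simp_all add: endo_comp endo_shift_endo endo_shift assms shift_gen shift_endo_gen)
  then show ?thesis
    by (metis comp_apply)
qed

lemma shift_endo_comp:
  assumes "endo f" "endo g"
  shows "shift_endo (f \<circ> g) = shift_endo f \<circ> shift_endo g"
proof (rule endo_eqI)
  fix i show "shift_endo (f \<circ> g) (gen i) = (shift_endo f \<circ> shift_endo g) (gen i)"
    by (cases i) (simp_all add: shift_endo_gen shift_endo_shift assms)
qed (simp_all add: endo_comp endo_shift_endo)

lemma shift_endo_id: "shift_endo id = id"
proof (rule endo_eqI)
  fix i show "shift_endo id (gen i) = id (gen i)"
    by (cases i) (simp_all add: shift_endo_gen shift_gen)
qed (simp_all add: endo_id endo_shift_endo)

lemma bij_shift_endo:
  assumes "endo f" "bij f"
  shows "bij (shift_endo f)"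
proof (rule o_bij)
  show "shift_endo (inv f) \<circ> shift_endo f = id"
    using assms by (simp add: shift_endo_comp[symmetric] endo_inv shift_endo_id
        bij_is_inj)
  show "shift_endo f \<circ> shift_endo (inv f) = id"
    using assms by (simp add: shift_endo_comp[symmetric] endo_inv shift_endo_id
        bij_is_surj surj_iff[THEN iffD1])
qed

text \<open>
  Both sides send \<open>a\<^sub>0\<close> to \<open>a\<^sub>0\<^sup>-\<^sup>1 a\<^sub>1\<^sup>-\<^sup>1 a\<^sub>2 a\<^sub>1 a\<^sub>0\<close>, \<open>a\<^sub>1\<close> to \<open>a\<^sub>0\<^sup>-\<^sup>1 a\<^sub>1 a\<^sub>0\<close> and \<open>a\<^sub>2\<close> to \<open>a\<^sub>0\<close>.
\<close>
lemma artin_braid: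
  "artin \<circ> shift_endo artin \<circ> artin = shift_endo artin \<circ> artin \<circ> shift_endo artin"
proof (rule endo_eqI)
  fix i
  consider "i = 0" | "i = 1" | "i = 2" | j where "i = Suc (Suc (Suc j))"
    by (metis One_nat_def nat.exhaust numeral_2_eq_2)
  then show "(artin \<circ> shift_endo artin \<circ> artin) (gen i)
    = (shift_endo artin \<circ> artin \<circ> shift_endo artin) (gen i)"
    by cases (simp_all add: numeral_2_eq_2 artin_gen shift_endo_gen shift_gen
        endo_simps[OF endo_artin] endo_simps[OF endo_shift_endo] endo_simps[OF endo_shift]
        minus_add add.assoc del: add_uminus_conv_diff)
qed (simp_all add: endo_comp endo_artin endo_shift_endo)

text \<open>
  The two maps move disjoint sets of generators: \<open>artin\<close> only \<open>gen 0\<close> and \<open>gen 1\<close>, and the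
  double shift only the others, among themselves.
\<close>
lemma artin_commute:
  assumes "endo f"
  shows "artin \<circ> shift_endo (shift_endo f) = shift_endo (shift_endo f) \<circ> artin"
proof (rule endo_eqI)
  have "artin \<circ> (shift \<circ> shift) = shift \<circ> shift"
    by (rule endo_eqI) (simp_all add: endo_comp endo_artin endo_shift shift_gen artin_gen)
  then have *: "artin (shift (shift u)) = shift (shift u)" for u
    by (metis comp_apply)
  fix i show "(artin \<circ> shift_endo (shift_endo f)) (gen i)
    = (shift_endo (shift_endo f) \<circ> artin) (gen i)"
    by (rule nat_cases_012[of i])
      (simp_all add: artin_gen shift_endo_gen shift_gen endo_simps[OF endo_shift_endo]
        shift_endo_shift endo_shift_endo assms *)
qed (simp_all add: endo_comp endo_artin endo_shift_endo)

section \<open>Words beginning with a power of the first generator\<close>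

definition begins :: "bool \<Rightarrow> free_group \<Rightarrow> bool" where
  "begins e u \<longleftrightarrow> (\<exists>w. word_of u = (0, e) # w)"

text \<open>
  The free product normal form, with the powers of \<open>a\<^sub>0\<close> written one letter at a time. The side
  condition of \<open>step\<close> excludes cancellation, and any injective endomorphism acting on the shifted
  syllables preserves it. This makes the action of \<open>shift_endo f\<close> visible, which it is not on the
  letters of a reduced word.
\<close>
inductive syllabic :: "bool \<Rightarrow> free_group \<Rightarrow> bool" where
  last: "syllabic e (letter (0, e) + shift t)"
| step: "syllabic d u \<Longrightarrow> t \<noteq> 0 \<or> d = e \<Longrightarrow> syllabic e (letter (0, e) + (shift t + u))"

lemma shift_letter: "shift (letter x) = letter (map_prod Suc id x)"
  by (cases x) (simp add: shift_gen endo_uminus endo_shift)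

text \<open>No cancellation happens at the seam, since no shifted letter has index 0.\<close>
lemma word_of_shift_add:
  assumes "\<forall>x w. word_of u = x # w \<longrightarrow> fst x = 0"
  shows "word_of (shift t + u) = map (map_prod Suc id) (word_of t) @ word_of u"
proof (induction t rule: free_group_induct)
  case zero
  show ?case by (simp add: endo_0 endo_shift)
next
  case (letter x t)
  let ?x = "map_prod Suc id x"
  have red: "reduced (x # word_of t)"
    using reduced_word_of[of "letter x + t"] letter(1) by metis
  have "word_of (shift (letter x + t) + u) = push ?x (word_of (shift t + u))"
    by (simp only: endo_add[OF endo_shift] shift_letter add.assoc word_of_letter_add)
  also have "\<dots> = ?x # word_of (shift t + u)"
    using red assms letter(2)
    by (cases x; cases "word_of t"; cases "word_of u") fastforce+
  finally show ?case
    by (simp only: letter list.map append_Cons)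
qed

lemma word_of_shift: "word_of (shift t) = map (map_prod Suc id) (word_of t)"
  using word_of_shift_add[of 0 t] by simp

lemma begins_if_syllabic: "syllabic e u \<Longrightarrow> begins e u"
proof (induction rule: syllabic.induct)
  case (last e t)
  then show ?case
    unfolding begins_def word_of_letter_add word_of_shift
    by (cases "word_of t") auto
next
  case (step d u t e)
  obtain w where w: "word_of u = (0, d) # w"
    using step by (auto simp: begins_def)
  have "word_of (shift t + u) = map (map_prod Suc id) (word_of t) @ word_of u"
    by (rule word_of_shift_add) (simp add: w)
  moreover have "t \<noteq> 0 \<Longrightarrow> word_of t \<noteq> []"
    by (metis word_of_0 word_of_eqI)
  ultimately show ?case
    using step.hyps w
    unfolding begins_def word_of_letter_add
    by (cases "word_of t") auto
qed

text \<open>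
  Here \<open>shift t\<close> collects the longest prefix of the word of \<open>u\<close> that avoids the index 0.
\<close>
lemma shift_splitE:
  obtains t u' where "u = shift t + u'" "length (word_of u') \<le> length (word_of u)"
    "u' = 0 \<or> (\<exists>d. begins d u')"
proof (induction u arbitrary: thesis rule: free_group_induct)
  case zero
  show ?case by (rule zero[of 0 0]) (simp_all add: endo_0 endo_shift)
next
  case (letter x u)
  obtain i e where x: "x = (i, e)" by (cases x)
  show ?case
  proof (cases i)
    case 0
    show ?thesis
      by (rule letter(3)[of 0 "letter x + u"])
        (use letter(1) in \<open>auto simp: endo_0 endo_shift begins_def x 0\<close>)
  next
    case (Suc j)
    obtain t u' where IH: "u = shift t + u'" "length (word_of u') \<le> length (word_of u)"
      "u' = 0 \<or> (\<exists>d. begins d u')"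
      using letter(2) by blast
    have sh: "letter x = shift (letter (j, e))"
      by (simp add: x Suc shift_gen endo_uminus endo_shift)
    show ?thesis
    proof (rule letter(3)[of "letter (j, e) + t" u'])
      show "letter x + u = shift (letter (j, e) + t) + u'"
        unfolding sh IH(1) by (simp add: endo_add[OF endo_shift] add.assoc)
      show "length (word_of u') \<le> length (word_of (letter x + u))"
        using IH(2) letter(1) by simp
      show "u' = 0 \<or> (\<exists>d. begins d u')" by fact
    qed
  qed
qed

lemma syllabic_if_begins: "begins e u \<Longrightarrow> syllabic e u"
proof (induction "length (word_of u)" arbitrary: e u rule: less_induct)
  case less
  obtain v where v: "word_of u = (0, e) # word_of v" "u = letter (0, e) + v"
    using less.prems word_of_ConsE unfolding begins_def by metis
  obtain t u' where s: "v = shift t + u'" "length (word_of u') \<le> length (word_of v)"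
    "u' = 0 \<or> (\<exists>d. begins d u')"
    using shift_splitE by blast
  show ?case
  proof (cases "u' = 0")
    case True
    then show ?thesis
      using syllabic.last[of e t] v s by simp
  next
    case False
    then obtain d where d: "begins d u'" using s by blast
    have "t \<noteq> 0 \<or> d = e"
    proof (rule ccontr)
      assume "\<not> ?thesis"
      then have "word_of v = (0, \<not> e) # tl (word_of v)"
        using s(1) d by (auto simp: begins_def endo_0 endo_shift)
      then have "\<not> reduced (word_of u)"
        by (metis v(1) letter_inv.simps reduced.simps(3))
      then show False by simp
    qed
    then show ?thesis
      using syllabic.step[of d u' t e] less.hyps[of u' d] d v s by simp
  qed
qed

text \<open>
  A normal form is carried to a normal form with the same powers of \<open>a\<^sub>0\<close>, because injectivity
  keeps nontrivial syllables nontrivial.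
\<close>
lemma begins_shift_endo:
  assumes "endo f" "inj f" "begins e u"
  shows "begins e (shift_endo f u)"
proof -
  have letter: "shift_endo f (letter (0, d)) = letter (0, d)" for d
    by (simp add: endo_uminus endo_shift_endo shift_endo_gen)
  have "syllabic e u \<Longrightarrow> syllabic e (shift_endo f u)"
  proof (induction rule: syllabic.induct)
    case (last e t)
    then show ?case
      using syllabic.last[of e "f t"]
      by (simp only: endo_add[OF endo_shift_endo] letter shift_endo_shift[OF assms(1)])
  next
    case (step d u t e)
    have "f t \<noteq> 0" if "t \<noteq> 0"
      using that assms(1,2) by (metis endo_0 injD)
    then show ?case
      using syllabic.step[of d "shift_endo f u" "f t" e] step
      by (simp only: endo_add[OF endo_shift_endo] letter shift_endo_shift[OF assms(1)]) blast
  qed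
  then show ?thesis
    using assms(3) begins_if_syllabic syllabic_if_begins by blast
qed

text \<open>
  The only danger to a leading \<open>a\<^sub>0\<^sup>-\<^sup>1\<close> in the image under \<open>artin\<close> is cancellation among the
  images of the letters, and a finite amount of information controls it: the first letter of a
  reduced word determines the beginning of the image as far as the next letter pushed in front
  can reach. For words beginning with \<open>a\<^sub>1\<close> or its inverse the beginning is only partly
  determined, and these restrictions are what makes the induction go through: \<open>a\<^sub>0\<^sup>-\<^sup>1 a\<^sub>1\<^sup>\<plusminus>\<^sup>1 a\<^sub>0\<close>,
  pushed in front, then loses at most its final \<open>a\<^sub>0\<close>.
\<close>
fun artin_shape :: "(nat \<times> bool) list \<Rightarrow> (nat \<times> bool) list \<Rightarrow> bool" where
  "artin_shape [] r \<longleftrightarrow> r = []"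
| "artin_shape ((i, e) # _) r \<longleftrightarrow>
     (if i = 0 then \<exists>s. r = (0, False) # (1, e) # s
      else if i = 1 then
        (if e then r \<noteq> [] \<and> hd r \<in> {(0, True), (1, True), (1, False)}
         else \<exists>s. r = (0, False) # s \<and> (s = [] \<or> fst (hd s) \<noteq> 1))
      else \<exists>s. r = (i, e) # s)"

text \<open>
  Reducedness enters where a letter is put in front of a word beginning with the same generator:
  it rules out the inverse letter, whose image would cancel completely.
\<close>
lemma artin_shape_word_of: "artin_shape (word_of u) (word_of (artin u))"
proof (induction u rule: free_group_induct)
  case zero
  show ?case by (simp add: endo_0 endo_artin)
next
  case (letter x u)
  obtain i e where x: "x = (i, e)" by (cases x)
  have red: "reduced (x # word_of u)"
    using reduced_word_of[of "letter x + u"] letter(1) by metis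
  have "word_of (artin (letter x + u)) =
    (if i = 0 then push (0, False) (push (1, e) (push (0, True) (word_of (artin u))))
     else if i = 1 then push (0, e) (word_of (artin u)) else push (i, e) (word_of (artin u)))"
    by (rule nat_cases_012[of i])
      (simp_all add: x endo_simps[OF endo_artin] artin_gen minus_add add.assoc word_of_gen_add
        del: add_uminus_conv_diff)
  moreover have "artin_shape (x # word_of u) \<dots>"
    using red letter(2)
    by (cases "word_of u"; cases "word_of (artin u)"; cases "tl (word_of (artin u))")
      (auto simp: x split: if_splits)
  ultimately show ?case
    using letter(1) by simp
qed

lemma begins_artin: "begins False u \<Longrightarrow> begins False (artin u)"
  using artin_shape_word_of[of u] by (auto simp: begins_def)

lemma begins_artin_gen: "begins False (artin (gen 0))"
  using artin_shape_word_of[of "gen 0"] by (auto simp: begins_def word_of_gen)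

lemma not_begins_gen: "\<not> begins False (gen 0)"
  by (simp add: begins_def word_of_gen)

section \<open>The group of automorphisms and its shifted conjugation\<close>

text \<open>Written additively as well: \<open>f + g\<close> applies \<open>g\<close> first.\<close>
typedef automorphism = "{f. endo f \<and> bij f}"
  morphisms app Abs_automorphism
  by (rule exI[of _ id]) (simp add: endo_id)

setup_lifting type_definition_automorphism

lemma endo_app: "endo (app f)" and bij_app: "bij (app f)"
  using app[of f] by simp_all

instantiation automorphism :: group_add
begin

lift_definition zero_automorphism :: automorphism is id
  by (simp add: endo_id)

lift_definition plus_automorphism :: "automorphism \<Rightarrow> automorphism \<Rightarrow> automorphism" is "(\<circ>)"
  by (simp add: endo_comp bij_comp)

lift_definition uminus_automorphism :: "automorphism \<Rightarrow> automorphism" is inv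
  by (simp add: endo_inv bij_imp_bij_inv)

definition minus_automorphism :: "automorphism \<Rightarrow> automorphism \<Rightarrow> automorphism" where
  "minus_automorphism f g = f + - g"

instance
proof
  fix f g h :: automorphism
  show "f + g + h = f + (g + h)"
    by transfer (simp add: comp_assoc)
  show "0 + f = f" "f + 0 = f"
    by (transfer, simp)+
  show "- f + f = 0"
    by transfer (simp add: bij_is_inj)
  show "f + - g = f - g"
    by (simp add: minus_automorphism_def)
qed

end

lift_definition shift_aut :: "automorphism \<Rightarrow> automorphism" is shift_endo
  by (simp add: endo_shift_endo bij_shift_endo)

lift_definition artin_aut :: automorphism is artin
  by (simp add: endo_artin bij_artin)

lemma shift_aut_add: "shift_aut (f + g) = shift_aut f + shift_aut g"
  by transfer (simp add: shift_endo_comp)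

lemma shift_aut_uminus: "shift_aut (- f) = - shift_aut f"
proof -
  have "shift_aut 0 = 0"
    by transfer (rule shift_endo_id)
  then show ?thesis
    using shift_aut_add[of "- f" f] by (simp add: eq_neg_iff_add_eq_0)
qed

lemma artin_aut_braid:
  "artin_aut + shift_aut artin_aut + artin_aut
   = shift_aut artin_aut + artin_aut + shift_aut artin_aut"
  by transfer (rule artin_braid)

lemma artin_aut_commute:
  "artin_aut + shift_aut (shift_aut f) = shift_aut (shift_aut f) + artin_aut"
  by transfer (simp add: artin_commute)

text \<open>
  On the subgroup generated by the iterated shifts of \<open>artin_aut\<close>, which is a copy of the braid
  group on infinitely many strands, this is Dehornoy's shifted conjugation.
\<close>
definition bracket :: "automorphism \<Rightarrow> automorphism \<Rightarrow> automorphism" where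
  "bracket f g = f + shift_aut g + artin_aut - shift_aut f"

text \<open>
  In both bracketings everything cancels against \<open>shift_aut f\<close> and its double shift except one
  word in \<open>artin_aut\<close> and its shift, where the braid relation makes the two sides agree. The
  commutation relation is what moves the double shifts out of the way.
\<close>
lemma bracket_distrib: "bracket f (bracket g h) = bracket (bracket f g) (bracket f h)"
proof -
  let ?s = shift_aut and ?x = artin_aut
  let ?y = "?s ?x" and ?f = "?s (?s f)" and ?h = "?s (?s h)"
  have braid: "?x + ?y + ?x - ?y = ?y + ?x"
    using artin_aut_braid by (simp add: diff_eq_eq add.assoc)
  have comm: "?x + - ?s (?s k) = - ?s (?s k) + ?x" for k
    using artin_aut_commute[of "- k"] by (simp add: shift_aut_uminus)
  have "bracket (bracket f g) (bracket f h)
      = f + ?s g + (?x + ?h) + ?y + - ?f + (?x + ?f) + - ?y + - ?s (?s g) + - ?s f"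
    by (simp add: bracket_def shift_aut_add shift_aut_uminus minus_add add.assoc
        diff_conv_add_uminus del: add_uminus_conv_diff)
  also have "\<dots> = f + ?s g + ?h + (?x + ?y + ?x - ?y) + - ?s (?s g) + - ?s f"
    by (simp add: artin_aut_commute add.assoc
        diff_conv_add_uminus del: add_uminus_conv_diff)
  also have "\<dots> = f + ?s g + ?h + ?y + (?x + - ?s (?s g)) + - ?s f"
    unfolding braid by (simp add: add.assoc del: add_uminus_conv_diff)
  also have "\<dots> = bracket f (bracket g h)"
    unfolding comm by (simp add: bracket_def shift_aut_add shift_aut_uminus add.assoc
        diff_conv_add_uminus del: add_uminus_conv_diff)
  finally show ?thesis ..
qed

section \<open>Irreflexivity\<close>

lemma begins_shift_aut: "begins e u \<Longrightarrow> begins e (app (shift_aut f) u)"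
  by (simp add: shift_aut.rep_eq begins_shift_endo endo_app bij_app bij_is_inj)

lemma app_shift_aut_gen: "app (shift_aut f) (gen 0) = gen 0"
  by (simp add: shift_aut.rep_eq shift_endo_gen)

lemma app_add: "app (f + g) u = app f (app g u)"
  by (simp add: plus_automorphism.rep_eq)

text \<open>
  The innermost factor \<open>- shift_aut f\<close> leaves \<open>gen 0\<close> where it is; the single occurrence of
  \<open>artin_aut\<close> then moves it into the set of words that begin with its inverse, and
  \<open>shift_aut g\<close> cannot move it out again.
\<close>
lemma begins_bracket_step:
  assumes "u = gen 0 \<or> begins False u"
  shows "begins False (app (- f + bracket f g) u)"
proof -
  have "- f + bracket f g = shift_aut g + artin_aut + shift_aut (- f)"
    by (simp add: bracket_def shift_aut_uminus add.assoc
        diff_conv_add_uminus del: add_uminus_conv_diff)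
  moreover have "begins False (artin (app (shift_aut (- f)) u))"
    using assms begins_artin begins_artin_gen begins_shift_aut app_shift_aut_gen by metis
  ultimately show ?thesis
    by (simp add: app_add artin_aut.rep_eq begins_shift_aut)
qed

text \<open>
  The quotient of the end by the start of a chain telescopes into the quotients of consecutive
  members. The statement is for all \<open>u\<close> that the chain can meet, not only for \<open>gen 0\<close>, because
  only the first quotient to act meets \<open>gen 0\<close>.
\<close>
lemma begins_foldl_bracket:
  assumes "gs \<noteq> []" "u = gen 0 \<or> begins False u"
  shows "begins False (app (- f + foldl bracket f gs) u)"
  using assms
proof (induction gs arbitrary: f)
  case (Cons g gs)
  let ?h = "bracket f g"
  have telescope: "- f + foldl bracket f (g # gs) = (- f + ?h) + (- ?h + foldl bracket ?h gs)"
    by (simp add: add.assoc del: add_uminus_conv_diff)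
  show ?case
  proof (cases "gs = []")
    case True
    then show ?thesis
      using begins_bracket_step[OF Cons.prems(2)] by simp
  next
    case False
    then have "begins False (app (- ?h + foldl bracket ?h gs) u)"
      using Cons by blast
    then show ?thesis
      unfolding telescope app_add[of "- f + ?h"] by (intro begins_bracket_step disjI2)
  qed
qed simp

theorem mainTheorem2:
  shows "\<not> (\<exists>a :: free_ld. ld_less UNIV (\<star>) a a)"
proof
  have "distributive_algebra UNIV bracket"
    unfolding distributive_algebra_def using bracket_distrib by blast
  then obtain h :: "free_ld \<Rightarrow> automorphism" where h: "\<And>a b. h (a \<star> b) = bracket (h a) (h b)"
    using free_ld_universal[of UNIV bracket 0] by blast
  have h_foldl: "h (foldl (\<star>) a bs) = foldl bracket (h a) (map h bs)" for a bs
    by (induction bs arbitrary: a) (simp_all add: h)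
  assume "\<exists>a :: free_ld. ld_less UNIV (\<star>) a a"
  then obtain a bs where "bs \<noteq> []" "a = foldl (\<star>) a bs"
    unfolding ld_less_def by blast
  then have "begins False (app (- h a + h a) (gen 0))"
    using begins_foldl_bracket[of "map h bs" "gen 0" "h a"] h_foldl[of a bs] by simp
  then show False
    by (simp add: not_begins_gen zero_automorphism.rep_eq)
qed

end
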